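(* Let $k$, $n$ and $s$ be positive integers and let $x_1,\ldots,x_n$ be independent variables. Then $$H_k^{(s)}(x_1,\ldots,x_n)=\begin{cases}\sum_{P\in\mathcal P_{n,k}^s}X^P, & \text{if } s \text{ is odd},\\[2pt] (-1)^k\sum_{P\in\mathcal P_{n,k}^s}(-1)^{P'}X^P, & \text{otherwise}.\end{cases}$$
   Context: For a positive integer $s$, $H_k^{(s)}$ ($k\ge0$) is defined by $\sum_{k\ge0}H_k^{(s)}(x_1,\ldots,x_n)t^k=\prod_{i=1}^n\big(1-x_it+\cdots+(-x_it)^s\big)^{-1}$. Consider lattice paths from $(0,0)$ to $(k,n-1)$ using unit east steps $(1,0)$ and unit north steps $(0,1)$. For such a path $P$ and $j=0,1,\ldots,n-1$, let $a_j(P)$ be the number of east steps of $P$ lying on the horizontal line $y=j$ (level $j+1$). $\mathcal P_{n,k}^s$ is the set of such paths with $a_j(P)\equiv0$ or $1\pmod{s+1}$ for every $j$. Each east step $p$ receives the label $L(p)=$ (number of north steps preceding $p$) $+1$, and $X^P=\prod_{p\text{ east step of }P}x_{L(p)}=\prod_{j=0}^{n-1}x_{j+1}^{a_j(P)}$. Let $n_{j+1}(P)$ be the least nonnegative residue of $a_j(P)$ modulo $s+1$, and $P'=\sum_{j}n_{j+1}(P)$. *)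

theory Defs
  imports
    "HOL-Library.Poly_Mapping"
    "HOL-Computational_Algebra.Formal_Power_Series"
    "HOL-Number_Theory.Cong"
begin

text \<open>
  A polynomial over \<open>'a\<close> in the variables \<open>x\<^sub>0, x\<^sub>1, x\<^sub>2, \<dots>\<close> is a finitely supported map from
  exponent vectors to coefficients; addition and convolution product are those of
  \<^theory>\<open>HOL-Library.Poly_Mapping\<close>. Only \<open>x\<^sub>1, \<dots>, x\<^sub>n\<close> are used below.
\<close>

type_synonym 'a mpolynomial = "(nat \<Rightarrow>\<^sub>0 nat) \<Rightarrow>\<^sub>0 'a"

definition Var :: "nat \<Rightarrow> 'a::comm_ring_1 mpolynomial" where
  "Var i = Poly_Mapping.single (Poly_Mapping.single i 1) 1"

text \<open>
  The operation \<^const>\<open>inverse\<close> on power series is only meaningful over division rings. Over a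
  commutative ring, \<^term>\<open>fps_right_inverse f 1\<close> is the inverse of a series \<open>f\<close> with constant
  coefficient \<open>1\<close>.
\<close>

definition fps_recip :: "'a::comm_ring_1 fps \<Rightarrow> 'a fps" where
  "fps_recip f = fps_right_inverse f 1"

lemma fps_recip:
  assumes "fps_nth f 0 = 1"
  shows "f * fps_recip f = 1"
  using assms by (simp add: fps_recip_def fps_right_inverse)

definition alt_series :: "nat \<Rightarrow> 'a::comm_ring_1 \<Rightarrow> 'a fps" where
  "alt_series s y = (\<Sum>j\<le>s. (- (fps_const y * fps_X)) ^ j)"

lemma alt_series_nth_0: "fps_nth (alt_series s y) 0 = 1"
proof -
  have "fps_nth (alt_series s y) 0 = (\<Sum>j\<le>s. if j = 0 then 1 else 0)"
    unfolding alt_series_def fps_sum_nth by (intro sum.cong) (auto simp: fps_power_zeroth zero_power)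
  then show ?thesis by simp
qed

text \<open>\<open>H s n k x\<close> is \<open>H\<^sub>k(x\<^sub>1, \<dots>, x\<^sub>n)\<close> for the parameter \<open>s\<close>; only \<open>x 1, \<dots>, x n\<close> matter.\<close>

definition H :: "nat \<Rightarrow> nat \<Rightarrow> nat \<Rightarrow> (nat \<Rightarrow> 'a::comm_ring_1) \<Rightarrow> 'a" where
  "H s n k x = fps_nth (\<Prod>i=1..n. fps_recip (alt_series s (x i))) k"

datatype step = East | North

text \<open>
  A path starting at \<open>(0,0)\<close> is its list of steps; \<open>pos P i\<close> is the lattice point reached
  after the first \<open>i\<close> steps, and step \<open>P ! i\<close> leads from \<open>pos P i\<close> to \<open>pos P (Suc i)\<close>.
\<close>

definition pos :: "step list \<Rightarrow> nat \<Rightarrow> nat \<times> nat" where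
  "pos P i = (count_list (take i P) East, count_list (take i P) North)"

definition east_steps :: "step list \<Rightarrow> nat set" where
  "east_steps P = {i. i < length P \<and> P ! i = East}"

definition lattice_paths :: "nat \<times> nat \<Rightarrow> step list set" where
  "lattice_paths q = {P. pos P (length P) = q}"

definition east_count :: "step list \<Rightarrow> nat \<Rightarrow> nat" where
  "east_count P j = card {i \<in> east_steps P. snd (pos P i) = j}"

definition paths :: "nat \<Rightarrow> nat \<Rightarrow> nat \<Rightarrow> step list set" where
  "paths s n k = {P \<in> lattice_paths (k, n - 1).
     \<forall>j\<in>{0..n - 1}. [east_count P j = 0] (mod (s + 1)) \<or> [east_count P j = 1] (mod (s + 1))}"

lemma finite_lattice_paths: "finite (lattice_paths q)"
proof (rule finite_subset)
  have *: "length P = count_list P East + count_list P North" for P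
  proof (induction P)
    case (Cons p P)
    then show ?case by (cases p) auto
  qed simp
  show "lattice_paths q \<subseteq> {P. set P \<subseteq> {East, North} \<and> length P = fst q + snd q}"
  proof
    fix P assume "P \<in> lattice_paths q"
    then have "q = (count_list P East, count_list P North)"
      by (simp add: lattice_paths_def pos_def)
    moreover have "set P \<subseteq> {East, North}"
      using step.exhaust by blast
    ultimately show "P \<in> {P. set P \<subseteq> {East, North} \<and> length P = fst q + snd q}"
      using *[of P] by simp
  qed
qed (simp add: finite_lists_length_eq)

lemma finite_paths: "finite (paths s n k)"
  unfolding paths_def using finite_lattice_paths by auto

text \<open>The number of north steps preceding the \<open>i\<close>-th step is the height of \<open>pos P i\<close>.\<close>

definition label :: "step list \<Rightarrow> nat \<Rightarrow> nat" where
  "label P i = count_list (take i P) North + 1"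

definition path_monom :: "(nat \<Rightarrow> 'a::comm_ring_1) \<Rightarrow> step list \<Rightarrow> 'a" where
  "path_monom x P = (\<Prod>i\<in>east_steps P. x (label P i))"

definition residue_sum :: "nat \<Rightarrow> nat \<Rightarrow> step list \<Rightarrow> nat" where
  "residue_sum s n P = (\<Sum>j=0..n - 1. east_count P j mod (s + 1))"

end

theory Submission
  imports Defs
begin

text \<open>
  Writing \<open>d = s + 1\<close>, the geometric sum gives
  \<open>(1 + y t) (1 - y t + \<dots> + (-y t)\<^sup>s) = 1 - (-y t)\<^sup>d\<close>, so the reciprocal of the truncated
  series is \<open>(1 + y t) \<Sum>\<^sub>m (-y t)\<^bsup>m d\<^esup>\<close>. Its coefficient at \<open>t\<^sup>a\<close> is \<open>(-1)\<^bsup>a + a mod d\<^esup> y\<^sup>a\<close> when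
  \<open>a mod d\<close> is \<open>0\<close> or \<open>1\<close>, and vanishes otherwise. Expanding the product over the
  variables amounts to choosing the number of east steps on every level, that is, a path. The
  signs multiply to \<open>(-1)\<^bsup>k + P'\<^esup>\<close>, which is \<open>1\<close> if \<open>d\<close> is even, since then \<open>k\<close> and \<open>P'\<close> have
  the same parity.
\<close>

section \<open>Reciprocal of one truncated series\<close>

definition recip_coeff :: "nat \<Rightarrow> nat \<Rightarrow> 'a::comm_ring_1 \<Rightarrow> 'a" where
  "recip_coeff s a y = (if [a = 0] (mod (s + 1)) \<or> [a = 1] (mod (s + 1))
     then (- 1) ^ (a + a mod (s + 1)) * y ^ a else 0)"

lemma alt_series_geometric:
  "(1 + fps_const y * fps_X) * alt_series s y = 1 - fps_const ((- y) ^ (s + 1)) * fps_X ^ (s + 1)"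
proof -
  define z where "z = - (fps_const y * fps_X)"
  have z: "z = fps_const (- y) * fps_X"
    by (simp add: z_def flip: fps_const_neg)
  have "(1 - z) * (\<Sum>j\<le>s. z ^ j) = 1 - z ^ (s + 1)"
    by (simp add: sum_gp_basic)
  moreover have "z ^ (s + 1) = fps_const ((- y) ^ (s + 1)) * fps_X ^ (s + 1)"
    unfolding z power_mult_distrib fps_const_power ..
  moreover have "1 + fps_const y * fps_X = 1 - z"
    by (simp add: z_def)
  ultimately show ?thesis
    by (simp only: alt_series_def z_def)
qed

text \<open>Adding \<open>s + 1\<close> to \<open>a\<close> keeps its residue, so only the sign and
  the power of \<open>y\<close> change. This recurrence makes the product with
  \<open>1 - (-y t)^(s+1)\<close> telescope.\<close>

lemma recip_coeff_shift:
  "recip_coeff s (a + (s + 1)) y = (- y) ^ (s + 1) * recip_coeff s a y"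
proof -
  define d where "d = s + 1"
  have "(- 1) ^ (a + d + a mod d) * y ^ (a + d) = ((- 1) ^ d * y ^ d) * ((- 1) ^ (a + a mod d) * y ^ a)"
    by (simp only: power_add mult_ac)
  also have "(- 1) ^ d * y ^ d = (- y) ^ d"
    by (rule power_minus[symmetric])
  finally show ?thesis
    unfolding recip_coeff_def cong_def d_def[symmetric] by simp
qed

text \<open>These are the initial values of the recurrence. Since \<open>s > 0\<close>, the residue
  of 1 is 1, so the sign exponent at \<open>a = 1\<close> is 2 and the value is
  \<open>+ y\<close>.\<close>

lemma recip_coeff_less:
  assumes "s > 0" "a < s + 1"
  shows "recip_coeff s a y = (if a = 0 then 1 else if a = 1 then y else 0)"
  using assms by (auto simp: recip_coeff_def cong_def)

lemma fps_recip_alt_series: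
  fixes y :: "'a::comm_ring_1"
  assumes "s > 0"
  shows "fps_recip (alt_series s y) = Abs_fps (\<lambda>a. recip_coeff s a y)"
proof -
  let ?C = "Abs_fps (\<lambda>a. recip_coeff s a y)"
  let ?D = "1 - fps_const ((- y) ^ (s + 1)) * fps_X ^ (s + 1)"
  have "?C * ?D = 1 + fps_const y * fps_X"
  proof (rule fps_ext)
    fix a
    have "fps_nth (?C * ?D) a = recip_coeff s a y -
        (if a < s + 1 then 0 else (- y) ^ (s + 1) * recip_coeff s (a - (s + 1)) y)"
      using fps_X_power_mult_right_nth[of "fps_const ((- y) ^ (s + 1)) * ?C" "s + 1" a]
      by (simp add: algebra_simps del: power_Suc)
    also have "\<dots> = (if a = 0 then 1 else if a = 1 then y else 0)"
    proof (cases "a < s + 1")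
      case True
      then show ?thesis unfolding recip_coeff_less[OF assms True] by simp
    next
      case False
      then show ?thesis using assms recip_coeff_shift[of s "a - (s + 1)" y] by simp
    qed
    also have "\<dots> = fps_nth (1 + fps_const y * fps_X) a"
      by simp
    finally show "fps_nth (?C * ?D) a = fps_nth (1 + fps_const y * fps_X) a" .
  qed
  then have "alt_series s y * ?C * ?D = ?D"
    using alt_series_geometric[of y s] by (simp add: mult_ac del: power_Suc)
  \<comment> \<open>\<open>?D\<close> is cancelled by multiplying with its reciprocal, which exists
    because its constant coefficient is 1; the ring may have zero divisors.\<close>
  moreover have "?D * fps_recip ?D = 1"
    by (rule fps_recip) (simp del: power_Suc)
  ultimately have AC: "alt_series s y * ?C = 1"
    using mult.assoc[of "alt_series s y * ?C" ?D "fps_recip ?D"]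
    by (simp only: mult_1_right)
  \<comment> \<open>Uniqueness of inverses in a commutative ring.\<close>
  have "fps_recip (alt_series s y) = (alt_series s y * ?C) * fps_recip (alt_series s y)"
    by (simp only: AC mult_1_left)
  also have "\<dots> = ?C * (alt_series s y * fps_recip (alt_series s y))"
    by (simp only: mult_ac)
  also have "\<dots> = ?C"
    by (simp only: fps_recip[OF alt_series_nth_0] mult_1_right)
  finally show ?thesis .
qed

section \<open>Path statistics level by level\<close>

lemma east_steps_snoc:
  "east_steps (P @ [p]) = (if p = East then insert (length P) (east_steps P) else east_steps P)"
  by (auto simp: east_steps_def nth_append less_Suc_eq)

lemma finite_east_steps: "finite (east_steps P)"
  by (simp add: east_steps_def)

lemma length_notin_east_steps: "length P \<notin> east_steps P"
  by (simp add: east_steps_def)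

lemma east_count_Nil [simp]: "east_count [] j = 0"
  by (simp add: east_count_def east_steps_def)

text \<open>The height at which a step starts depends only on the steps before it, so an appended
  step affects at most the count at the final height of \<open>P\<close>.\<close>

lemma east_count_snoc:
  "east_count (P @ [p]) j = east_count P j + (if p = East \<and> count_list P North = j then 1 else 0)"
proof -
  have "{i \<in> east_steps (P @ [p]). snd (pos (P @ [p]) i) = j} =
      (if p = East \<and> count_list P North = j then insert (length P) else id)
        {i \<in> east_steps P. snd (pos P i) = j}"
    by (auto simp: east_steps_def pos_def nth_append less_Suc_eq)
  then show ?thesis
    by (simp add: east_count_def finite_east_steps length_notin_east_steps)
qed

lemma path_monom_snoc:
  "path_monom x (P @ [p]) =
     path_monom x P * (if p = East then x (count_list P North + 1) else 1)"
proof -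
  have "label (P @ [p]) i = label P i" if "i \<in> east_steps P" for i
    using that by (simp add: label_def east_steps_def)
  then have "(\<Prod>i\<in>east_steps P. x (label (P @ [p]) i)) = path_monom x P"
    by (simp add: path_monom_def)
  moreover have "label (P @ [p]) (length P) = count_list P North + 1"
    by (simp add: label_def)
  ultimately show ?thesis
    by (cases p) (simp_all add: path_monom_def[of x "P @ [_]"] east_steps_snoc finite_east_steps
        length_notin_east_steps mult.commute)
qed

text \<open>Every east step lies on exactly one level. Bounding the final height by
  \<open>m\<close>, instead of fixing it, lets the induction remove a north step.\<close>

lemma count_list_East_eq_sum:
  "count_list P North \<le> m \<Longrightarrow> count_list P East = (\<Sum>j\<le>m. east_count P j)"
  by (induction P rule: rev_induct) (auto simp: east_count_snoc sum.distrib split: if_splits)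

lemma path_monom_eq_prod:
  "count_list P North \<le> m \<Longrightarrow> path_monom x P = (\<Prod>j\<le>m. x (Suc j) ^ east_count P j)"
proof (induction P rule: rev_induct)
  case Nil
  then show ?case by (simp add: path_monom_def east_steps_def)
next
  case (snoc p P)
  \<comment> \<open>The contribution of the last step is spread over all levels as a product with at
    most one nontrivial factor.\<close>
  have "(\<Prod>j\<le>m. x (Suc j) ^ east_count (P @ [p]) j) =
      (\<Prod>j\<le>m. x (Suc j) ^ east_count P j) *
      (\<Prod>j\<le>m. if count_list P North = j then if p = East then x (Suc j) else 1 else 1)"
    unfolding prod.distrib[symmetric] by (intro prod.cong) (auto simp: east_count_snoc)
  also have "\<dots> = path_monom x (P @ [p])"
    using snoc by (auto simp: path_monom_snoc split: if_splits)
  finally show ?case ..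
qed

lemma east_count_eq_0: "count_list P North < j \<Longrightarrow> east_count P j = 0"
  by (induction P rule: rev_induct) (auto simp: east_count_snoc split: if_splits)

lemma count_list_replicate_East:
  "count_list (replicate b East) East = b" "count_list (replicate b East) North = 0"
  by (induction b) auto

lemma east_count_append_replicate:
  "east_count (P @ replicate b East) j =
     east_count P j + (if count_list P North = j then b else 0)"
proof (induction b)
  case (Suc b)
  have "east_count (P @ replicate (Suc b) East) j =
      east_count ((P @ replicate b East) @ [East]) j"
    by (simp add: replicate_append_same)
  then show ?case
    using Suc by (auto simp only: east_count_snoc) (auto simp: count_list_replicate_East)
qed simp

section \<open>Splitting a path at its last north step\<close>

lemma lattice_paths_iff:
  "P \<in> lattice_paths (k, m) \<longleftrightarrow> count_list P East = k \<and> count_list P North = m"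
  by (simp add: lattice_paths_def pos_def)

lemma no_North_replicate: "North \<notin> set P \<Longrightarrow> P = replicate (length P) East"
  by (metis replicate_eqI step.exhaust)

lemma lattice_paths_0: "lattice_paths (k, 0) = {replicate k East}"
proof -
  have "P = replicate k East" if "count_list P East = k" "count_list P North = 0" for P
    using no_North_replicate[of P] that count_list_replicate_East
    by (metis count_list_0_iff)
  then show ?thesis
    by (auto simp: lattice_paths_iff count_list_replicate_East)
qed

text \<open>Cutting at the last north step leaves a path \<open>P\<close> one level lower and a run
  of \<open>b\<close> east steps on the top level.\<close>

lemma bij_betw_lattice_paths_Suc:
  "bij_betw (\<lambda>(b, P). P @ North # replicate b East)
     (SIGMA b:{..k}. lattice_paths (k - b, m)) (lattice_paths (k, Suc m))"
proof (rule bij_betwI')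
  fix u v :: "nat \<times> step list"
  obtain b P c Q where uv: "u = (b, P)" "v = (c, Q)"
    by fastforce
  have "b = c \<and> P = Q" if "P @ North # replicate b East = Q @ North # replicate c East"
  proof -
    \<comment> \<open>After reversal the final east run comes first and ends at a north step, so
      \<open>takeWhile\<close> recovers its length.\<close>
    have "replicate b East @ North # rev P = replicate c East @ North # rev Q"
      using arg_cong[OF that, of rev] by simp
    from arg_cong[OF this, of "takeWhile (\<lambda>p. p = East)"] have "b = c"
      by (simp add: takeWhile_append)
    with that show ?thesis by simp
  qed
  then show "((case u of (b, P) \<Rightarrow> P @ North # replicate b East) =
      (case v of (b, P) \<Rightarrow> P @ North # replicate b East)) = (u = v)"
    using uv by auto
next
  fix u assume "u \<in> (SIGMA b:{..k}. lattice_paths (k - b, m))"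
  then show "(case u of (b, P) \<Rightarrow> P @ North # replicate b East) \<in> lattice_paths (k, Suc m)"
    by (auto simp: lattice_paths_iff count_list_replicate_East)
next
  fix R assume R: "R \<in> lattice_paths (k, Suc m)"
  then have "North \<in> set R"
    by (metis count_notin lattice_paths_iff nat.distinct(1))
  then obtain P Q where PQ: "R = P @ North # Q" "North \<notin> set Q"
    using split_list_last by metis
  then have "R = P @ North # replicate (length Q) East"
    using no_North_replicate by metis
  with R show "\<exists>u\<in>SIGMA b:{..k}. lattice_paths (k - b, m).
      R = (case u of (b, P) \<Rightarrow> P @ North # replicate b East)"
    by (intro bexI[of _ "(length Q, P)"]) (auto simp: lattice_paths_iff count_list_replicate_East)
qed

section \<open>From products of power series to sums over paths\<close>

text \<open>Choosing an exponent from each factor is choosing the number of east steps on each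
  level. The induction peels off the top level; \<open>k\<close> stays arbitrary because
  \<open>k - b\<close> east steps remain below.\<close>

lemma fps_prod_nth_lattice_paths:
  fixes c :: "nat \<Rightarrow> nat \<Rightarrow> 'a::comm_ring_1"
  shows "fps_nth (\<Prod>j\<le>m. Abs_fps (c j)) k =
    (\<Sum>P\<in>lattice_paths (k, m). \<Prod>j\<le>m. c j (east_count P j))"
proof (induction m arbitrary: k)
  case 0
  show ?case
    using east_count_append_replicate[of "[]" k 0] by (simp add: lattice_paths_0)
next
  case (Suc m)
  have weight: "(\<Prod>j\<le>Suc m. c j (east_count (P @ North # replicate b East) j)) =
      c (Suc m) b * (\<Prod>j\<le>m. c j (east_count P j))"
    if "P \<in> lattice_paths (k - b, m)" for b P
  proof -
    have "east_count (P @ North # replicate b East) j =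
        east_count P j + (if j = Suc m then b else 0)" for j
      using that east_count_append_replicate[of "P @ [North]" b j]
      by (auto simp: east_count_snoc lattice_paths_iff)
    \<comment> \<open>\<open>P\<close> ends at height \<open>m\<close>, so the top level carries
      only the \<open>b\<close> appended steps.\<close>
    moreover have "east_count P (Suc m) = 0"
      using that by (simp add: east_count_eq_0 lattice_paths_iff)
    ultimately show ?thesis by (simp add: mult.commute)
  qed
  have "fps_nth (\<Prod>j\<le>Suc m. Abs_fps (c j)) k =
      fps_nth (Abs_fps (c (Suc m)) * (\<Prod>j\<le>m. Abs_fps (c j))) k"
    by (simp add: mult.commute)
  also have "\<dots> = (\<Sum>b\<le>k. \<Sum>P\<in>lattice_paths (k - b, m).
      c (Suc m) b * (\<Prod>j\<le>m. c j (east_count P j)))"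
    by (simp add: fps_mult_nth Suc.IH sum_distrib_left atLeast0AtMost)
  also have "\<dots> = (\<Sum>(b, P)\<in>(SIGMA b:{..k}. lattice_paths (k - b, m)).
      c (Suc m) b * (\<Prod>j\<le>m. c j (east_count P j)))"
    by (rule sum.Sigma) (auto simp: finite_lattice_paths)
  also have "\<dots> = (\<Sum>u\<in>(SIGMA b:{..k}. lattice_paths (k - b, m)).
      (\<lambda>R. \<Prod>j\<le>Suc m. c j (east_count R j)) ((\<lambda>(b, P). P @ North # replicate b East) u))"
    by (rule sum.cong) (auto simp: weight simp del: prod.atMost_Suc)
  also have "\<dots> = (\<Sum>P\<in>lattice_paths (k, Suc m). \<Prod>j\<le>Suc m. c j (east_count P j))"
    by (rule sum.reindex_bij_betw[OF bij_betw_lattice_paths_Suc])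
  finally show ?case .
qed

lemma H_eq_signed_sum:
  fixes x :: "nat \<Rightarrow> 'a::comm_ring_1"
  assumes "n > 0" "s > 0"
  shows "H s n k x = (\<Sum>P\<in>paths s n k. (- 1) ^ (k + residue_sum s n P) * path_monom x P)"
proof -
  obtain m where n: "n = Suc m"
    using assms(1) gr0_conv_Suc by blast
  have "H s n k x = fps_nth (\<Prod>j\<le>m. Abs_fps (\<lambda>a. recip_coeff s a (x (Suc j)))) k"
    using assms(2) unfolding H_def n
    by (simp only: fps_recip_alt_series prod.atLeast1_atMost_eq lessThan_Suc_atMost One_nat_def)
  also have "\<dots> = (\<Sum>P\<in>lattice_paths (k, m). \<Prod>j\<le>m. recip_coeff s (east_count P j) (x (Suc j)))"
    by (rule fps_prod_nth_lattice_paths)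
  \<comment> \<open>A path with a forbidden residue on some level has a zero factor there.\<close>
  also have "\<dots> = (\<Sum>P\<in>paths s n k. \<Prod>j\<le>m. recip_coeff s (east_count P j) (x (Suc j)))"
    by (rule sum.mono_neutral_right)
      (auto simp: paths_def n finite_lattice_paths recip_coeff_def intro!: prod_zero)
  also have "\<dots> = (\<Sum>P\<in>paths s n k. (- 1) ^ (k + residue_sum s n P) * path_monom x P)"
  proof (rule sum.cong[OF refl])
    fix P assume P: "P \<in> paths s n k"
    then have counts: "count_list P North = m" "count_list P East = k"
      by (auto simp: paths_def n lattice_paths_iff)
    have "(\<Prod>j\<le>m. recip_coeff s (east_count P j) (x (Suc j))) =
        (\<Prod>j\<le>m. (- 1) ^ (east_count P j + east_count P j mod (s + 1)) *
          x (Suc j) ^ east_count P j)"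
      using P by (intro prod.cong) (auto simp: recip_coeff_def paths_def n)
    \<comment> \<open>The level signs combine: the counts add up to \<open>k\<close> and their
      residues to \<open>residue_sum s n P\<close>.\<close>
    also have "\<dots> = (- 1) ^ (\<Sum>j\<le>m. east_count P j + east_count P j mod (s + 1)) *
        (\<Prod>j\<le>m. x (Suc j) ^ east_count P j)"
      by (simp only: prod.distrib power_sum)
    also have "\<dots> = (- 1) ^ (k + residue_sum s n P) * path_monom x P"
      using counts count_list_East_eq_sum[of P m] path_monom_eq_prod[of P m x]
      by (simp add: sum.distrib residue_sum_def n atLeast0AtMost)
    finally show "(\<Prod>j\<le>m. recip_coeff s (east_count P j) (x (Suc j))) =
      (- 1) ^ (k + residue_sum s n P) * path_monom x P" .
  qed
  finally show ?thesis .
qed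

lemma even_add_residue_sum:
  assumes "odd s" "n > 0" "P \<in> paths s n k"
  shows "even (k + residue_sum s n P)"
proof -
  have "k = (\<Sum>j=0..n - 1. east_count P j)"
    using assms(3) count_list_East_eq_sum[of P "n - 1"]
    by (simp add: paths_def lattice_paths_iff atLeast0AtMost)
  then have "k + residue_sum s n P = (\<Sum>j=0..n - 1. east_count P j + east_count P j mod (s + 1))"
    by (simp add: residue_sum_def sum.distrib)
  \<comment> \<open>The modulus \<open>s + 1\<close> is even, so reduction preserves parity.\<close>
  moreover have "even (a + a mod (s + 1))" for a
    using assms(1) by (simp add: dvd_mod_iff)
  ultimately show ?thesis
    by (simp add: dvd_sum)
qed

theorem theorem4p7:
  fixes k n s :: nat
  assumes "k > 0" and "n > 0" and "s > 0"
  shows "H s n k (Var :: nat \<Rightarrow> 'a::comm_ring_1 mpolynomial) =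
    (if odd s then (\<Sum>P\<in>paths s n k. path_monom Var P)
     else (- 1) ^ k * (\<Sum>P\<in>paths s n k. (- 1) ^ residue_sum s n P * path_monom Var P))"
proof (cases "odd s")
  case True
  then show ?thesis
    unfolding H_eq_signed_sum[OF assms(2,3)] using even_add_residue_sum[OF True assms(2)]
    by (auto intro!: sum.cong)
next
  case False
  then show ?thesis
    using assms by (simp add: H_eq_signed_sum power_add sum_distrib_left mult.assoc)
qed

end
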